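(* Let $A$ be a finite set and let $\rho$ be a nontrivial equivalence relation on $A$ (neither the equality relation nor $A\times A$) all of whose equivalence classes have the same size. Then $\mathrm{PPol}(\rho)$ is borrow closed and ancilla closed, and it is maximal among the proper borrow closed (respectively, proper ancilla closed) permutation clones on $A$: there is no borrow closed permutation clone $C$ with $\mathrm{PPol}(\rho)\subsetneq C\subsetneq B(A)$.
   Context: $B_n(A)=\mathrm{Sym}(A^n)$, $B(A)=\bigcup_n B_n(A)$. Wire permutations $\pi_\alpha$ ($\alpha\in S_n$) permute coordinates of $A^n$; $i_n$ is the identity of $A^n$; $f\oplus g$ (parallel composition) applies $f\in B_n(A)$ to the first $n$ and $g\in B_m(A)$ to the last $m$ coordinates; serial composition $\bullet$ is composition of permutations after padding the smaller arity map with identities on extra coordinates. A permutation clone is a subset of $B(A)$ containing all wire permutations and closed under $\oplus$ and $\bullet$. For a relation $R\subseteq A^k$, $\mathrm{PPol}(R)$ is the set of $f\in B_n(A)$ ($n\in\mathbb{N}$) such that for every $k\times n$ array with all columns in $R$, applying $f$ to each row yields an array with all columns in $R$. $C$ is borrow closed if $f\oplus i_1\in C$ implies $f\in C$. $C$ is ancilla closed if whenever $f\in B_n(A)$, $g\in C\cap B_{n+1}(A)$ and $a\in A$ satisfy $g(x_1,\dots,x_n,a)=(f(x_1,\dots,x_n),a)$ for all $x\in A^n$, then $f\in C$. *)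

theory Defs
  imports "HOL-Combinatorics.Permutations" "HOL-Library.NList"
begin

text \<open>
  A tuple in \<open>A\<^sup>n\<close> is a list in \<open>nlists n A\<close>, and a permutation of \<open>A\<^sup>n\<close> is extended by the
  identity to all lists, so that the underlying functions alone do not determine the arity (all
  identities are \<open>id\<close>). A member of \<open>B(A)\<close> is therefore the pair of its arity and its function.
\<close>

type_synonym 'a gate = "nat \<times> ('a list \<Rightarrow> 'a list)"

definition B_n :: "'a set \<Rightarrow> nat \<Rightarrow> ('a list \<Rightarrow> 'a list) set" where
  "B_n A n = {f. f permutes nlists n A}"

definition B :: "'a set \<Rightarrow> 'a gate set" where
  "B A = {(n, f). f \<in> B_n A n}"

definition wire_perm :: "'a set \<Rightarrow> nat \<Rightarrow> (nat \<Rightarrow> nat) \<Rightarrow> 'a gate" where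
  "wire_perm A n \<alpha> = (n, \<lambda>xs. if xs \<in> nlists n A then permute_list \<alpha> xs else xs)"

definition ident :: "nat \<Rightarrow> 'a gate" where
  "ident n = (n, id)"

definition par :: "'a set \<Rightarrow> 'a gate \<Rightarrow> 'a gate \<Rightarrow> 'a gate" where
  "par A p q =
     (fst p + fst q,
      \<lambda>xs. if xs \<in> nlists (fst p + fst q) A
           then snd p (take (fst p) xs) @ snd q (drop (fst p) xs) else xs)"

definition pad :: "'a set \<Rightarrow> nat \<Rightarrow> 'a gate \<Rightarrow> 'a gate" where
  "pad A k p = par A p (ident (k - fst p))"

definition serial :: "'a set \<Rightarrow> 'a gate \<Rightarrow> 'a gate \<Rightarrow> 'a gate" where
  "serial A p q =
     (max (fst p) (fst q),
      snd (pad A (max (fst p) (fst q)) p) \<circ> snd (pad A (max (fst p) (fst q)) q))"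

definition permutation_clone :: "'a set \<Rightarrow> 'a gate set \<Rightarrow> bool" where
  "permutation_clone A C \<longleftrightarrow>
     C \<subseteq> B A \<and>
     (\<forall>n \<alpha>. \<alpha> permutes {..<n} \<longrightarrow> wire_perm A n \<alpha> \<in> C) \<and>
     (\<forall>p\<in>C. \<forall>q\<in>C. par A p q \<in> C) \<and>
     (\<forall>p\<in>C. \<forall>q\<in>C. serial A p q \<in> C)"

text \<open>A \<open>k \<times> n\<close> array over \<open>A\<close> is the list of its rows, an element of
  \<open>nlists k (nlists n A)\<close>.\<close>

definition column :: "'a list list \<Rightarrow> nat \<Rightarrow> 'a list" where
  "column M j = map (\<lambda>row. row ! j) M"

definition PPol :: "'a set \<Rightarrow> nat \<Rightarrow> 'a list set \<Rightarrow> 'a gate set" where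
  "PPol A k R =
     {(n, f) \<in> B A. \<forall>M \<in> nlists k (nlists n A).
        (\<forall>j<n. column M j \<in> R) \<longrightarrow> (\<forall>j<n. column (map f M) j \<in> R)}"

definition binary_rel :: "('a \<times> 'a) set \<Rightarrow> 'a list set" where
  "binary_rel \<rho> = {[x, y] | x y. (x, y) \<in> \<rho>}"

definition borrow_closed :: "'a set \<Rightarrow> 'a gate set \<Rightarrow> bool" where
  "borrow_closed A C \<longleftrightarrow> (\<forall>p \<in> B A. par A p (ident 1) \<in> C \<longrightarrow> p \<in> C)"

definition ancilla_closed :: "'a set \<Rightarrow> 'a gate set \<Rightarrow> bool" where
  "ancilla_closed A C \<longleftrightarrow>
     (\<forall>n. \<forall>f \<in> B_n A n. \<forall>g \<in> B_n A (n + 1). \<forall>a \<in> A.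
        (n + 1, g) \<in> C \<longrightarrow> (\<forall>xs \<in> nlists n A. g (xs @ [a]) = f xs @ [a]) \<longrightarrow> (n, f) \<in> C)"

end

theory Submission
  imports Defs
begin

text \<open>
  On \<open>A\<^sup>n\<close>, the gates of arity \<open>n\<close> in the clone of \<open>\<rho>\<close> form the stabilizer of a partition into blocks
  of equal size. This stabilizer is a maximal subgroup of the symmetric group: the relation
  ``the transposition of \<open>x\<close> and \<open>y\<close> lies in \<open>G\<close>'' is an equivalence for every group \<open>G\<close>; if \<open>G\<close>
  contains the stabilizer, this relation contains the blocks, an element outside the stabilizer
  makes it join two blocks, and exchanging blocks makes it join all of them. Hence a clone strictly
  above that of \<open>\<rho>\<close> contains all gates of every large arity, and borrowing gives the small arities.
\<close>

section \<open>Maximality of block stabilizers in finite symmetric groups\<close>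

lemma transpose_conj:
  assumes "bij h" "h \<circ> k = id"
  shows "h \<circ> transpose x y \<circ> k = transpose (h x) (h y)"
proof -
  have "h \<circ> transpose x y = transpose (h x) (h y) \<circ> h"
    using assms(1) by (auto simp: fun_eq_iff transpose_def bij_def inj_def)
  then show ?thesis
    using assms(2) by (metis comp_assoc comp_id)
qed

text \<open>Composition with \<open>g\<close> on the left is injective on the finite set
  \<open>G\<close>, hence onto \<open>G\<close>, and so it reaches \<open>id\<close>. Clones are
  closed under composition only; this supplies the inverses needed for conjugation.\<close>

lemma right_inverse_in_finite_submonoid:
  assumes "finite \<Omega>" and G: "\<And>g. g \<in> G \<Longrightarrow> g permutes \<Omega>"
    and comp: "\<And>g h. g \<in> G \<Longrightarrow> h \<in> G \<Longrightarrow> g \<circ> h \<in> G"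
    and "id \<in> G" and g: "g \<in> G"
  shows "\<exists>h\<in>G. g \<circ> h = id"
proof -
  have "finite G"
    using finite_permutations[OF \<open>finite \<Omega>\<close>] by (rule rev_finite_subset) (use G in auto)
  moreover have "inj_on ((\<circ>) g) G"
    using fun.inj_map[OF permutes_inj[OF G[OF g]]] by (rule inj_on_subset) simp
  ultimately have "(\<circ>) g ` G = G"
    using comp g by (intro endo_inj_surj) auto
  then show ?thesis
    using \<open>id \<in> G\<close> by (metis imageE)
qed

text \<open>Two classes of equal size are exchanged by a bijection and its inverse, with the
  identity elsewhere. Such an \<open>h\<close> lies in the stabilizer and moves one block while
  fixing all points of a third.\<close>

lemma exists_block_swap:
  assumes "finite \<Omega>" "equiv \<Omega> r"
    and eq: "\<And>x y. x \<in> \<Omega> \<Longrightarrow> y \<in> \<Omega> \<Longrightarrow> card (r `` {x}) = card (r `` {y})"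
    and pq: "p \<in> \<Omega>" "q \<in> \<Omega>" "(p, q) \<notin> r"
  shows "\<exists>h. h permutes \<Omega> \<and> (\<forall>x y. (x, y) \<in> r \<longrightarrow> (h x, h y) \<in> r) \<and> h p = q
    \<and> (\<forall>x. (p, x) \<notin> r \<longrightarrow> (q, x) \<notin> r \<longrightarrow> h x = x)"
proof -
  have sub: "r \<subseteq> \<Omega> \<times> \<Omega>" and sym: "\<And>x y. (x, y) \<in> r \<Longrightarrow> (y, x) \<in> r"
    and trans: "\<And>x y z. (x, y) \<in> r \<Longrightarrow> (y, z) \<in> r \<Longrightarrow> (x, z) \<in> r"
    and refl: "\<And>x. x \<in> \<Omega> \<Longrightarrow> (x, x) \<in> r"
    using \<open>equiv \<Omega> r\<close> by (auto simp: equiv_def refl_on_def dest: symD transD)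
  define P where "P = r `` {p}"
  define Q where "Q = r `` {q}"
  have fin: "finite P" "finite Q"
    unfolding P_def Q_def using sub \<open>finite \<Omega>\<close> by (auto intro: finite_subset)
  have mem: "p \<in> P" "q \<in> Q" "P \<subseteq> \<Omega>" "Q \<subseteq> \<Omega>"
    using refl pq sub by (auto simp: P_def Q_def)
  have disj: "P \<inter> Q = {}"
    using pq sym trans unfolding P_def Q_def by blast
  \<comment> \<open>The classes are matched without \<open>p\<close> and \<open>q\<close>, so that
    the bijection can then be extended by sending \<open>p\<close> to \<open>q\<close>.\<close>
  have "card (P - {p}) = card (Q - {q})"
    using eq[OF pq(1,2)] mem fin by (simp add: P_def Q_def)
  then obtain b where b: "bij_betw b (P - {p}) (Q - {q})"
    using fin finite_same_card_bij by blast
  define e where "e = (\<lambda>x. if x = p then q else b x)"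
  have "bij_betw e (P - {p}) (Q - {q})"
    using b by (rule bij_betw_cong[THEN iffD1, rotated]) (auto simp: e_def)
  then have "bij_betw e ((P - {p}) \<union> {p}) ((Q - {q}) \<union> {e p})"
    using notIn_Un_bij_betw[of p "P - {p}" e "Q - {q}"] by (auto simp: e_def)
  then have e: "bij_betw e P Q"
    using mem by (simp add: insert_absorb e_def)
  define d where "d = inv_into P e"
  have ePQ: "e x \<in> Q" "d (e x) = x" if "x \<in> P" for x
    using e that by (auto simp: d_def bij_betw_def)
  have dQP: "d x \<in> P" "e (d x) = x" if "x \<in> Q" for x
    using e that unfolding d_def bij_betw_def by (auto intro: inv_into_into f_inv_into_f)
  define h where "h = (\<lambda>x. if x \<in> P then e x else if x \<in> Q then d x else x)"
  have hh: "h (h x) = x" for x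
    using ePQ[of x] dQP[of x] disj by (auto simp: h_def)
  \<comment> \<open>\<open>h\<close> is an involution and serves as its own inverse.\<close>
  have "h permutes \<Omega>"
    by (rule bij_imp_permutes, rule bij_betw_byWitness[of _ h])
      (use hh ePQ dQP mem in \<open>auto simp: h_def\<close>)
  moreover have "h p = q"
    using mem by (simp add: h_def e_def)
  moreover have "(h x, h y) \<in> r" if xy: "(x, y) \<in> r" for x y
  proof -
    have "x \<in> P \<longleftrightarrow> y \<in> P" "x \<in> Q \<longleftrightarrow> y \<in> Q"
      using xy sym trans unfolding P_def Q_def by blast+
    moreover have "(u, v) \<in> r" if "u \<in> P \<and> v \<in> P \<or> u \<in> Q \<and> v \<in> Q" for u v
      using that sym trans unfolding P_def Q_def by blast
    ultimately show ?thesis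
      using xy ePQ dQP by (auto simp: h_def)
  qed
  ultimately show ?thesis
    by (intro exI[of _ h]) (auto simp: h_def P_def Q_def)
qed

text \<open>Closure under composition is what a clone offers on the gates of one arity, whence the
  form of the assumptions on \<open>G\<close>. Transpositions generate all permutations of the
  finite set \<Omega>, so it is enough to find every transposition in \<open>G\<close>.\<close>

lemma block_stabilizer_maximal:
  assumes fin: "finite \<Omega>" and r: "equiv \<Omega> r"
    and eq: "\<And>x y. x \<in> \<Omega> \<Longrightarrow> y \<in> \<Omega> \<Longrightarrow> card (r `` {x}) = card (r `` {y})"
    and G: "\<And>g. g \<in> G \<Longrightarrow> g permutes \<Omega>"
    and comp: "\<And>g h. g \<in> G \<Longrightarrow> h \<in> G \<Longrightarrow> g \<circ> h \<in> G"
    and stab: "\<And>h. h permutes \<Omega> \<Longrightarrow> (\<And>x y. (x, y) \<in> r \<Longrightarrow> (h x, h y) \<in> r) \<Longrightarrow> h \<in> G"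
    and f: "f \<in> G" "(x, y) \<in> r" "(f x, f y) \<notin> r"
    and g: "g permutes \<Omega>"
  shows "g \<in> G"
proof -
  have sub: "r \<subseteq> \<Omega> \<times> \<Omega>" and sym: "\<And>x y. (x, y) \<in> r \<Longrightarrow> (y, x) \<in> r"
    and trans: "\<And>x y z. (x, y) \<in> r \<Longrightarrow> (y, z) \<in> r \<Longrightarrow> (x, z) \<in> r"
    and refl: "\<And>x. x \<in> \<Omega> \<Longrightarrow> (x, x) \<in> r"
    using r by (auto simp: equiv_def refl_on_def dest: symD transD)
  have idG: "id \<in> G"
    by (rule stab) (auto simp: permutes_id)
  have conj: "transpose (h u) (h v) \<in> G" if "h \<in> G" "transpose u v \<in> G" for h u v
  proof -
    obtain k where "k \<in> G" "h \<circ> k = id"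
      using right_inverse_in_finite_submonoid[OF fin G comp idG \<open>h \<in> G\<close>] by blast
    then show ?thesis
      using transpose_conj[OF permutes_bij[OF G[OF \<open>h \<in> G\<close>]], of k u v] comp that by metis
  qed
  \<comment> \<open>A transposition inside a block keeps every point in its own block, so it belongs
    to the stabilizer.\<close>
  have blocks: "transpose u v \<in> G" if uv: "(u, v) \<in> r" for u v
  proof (rule stab)
    show "transpose u v permutes \<Omega>"
      using uv sub by (intro permutes_swap_id) auto
    show "(transpose u v x, transpose u v y) \<in> r" if "(x, y) \<in> r" for x y
      using that uv sym trans refl sub unfolding transpose_def by (smt (verit))
  qed
  define p q where "p = f x" and "q = f y"
  have xy: "x \<in> \<Omega>" "y \<in> \<Omega>"
    using f(2) sub by auto
  then have pq: "p \<in> \<Omega>" "q \<in> \<Omega>" "(p, q) \<notin> r"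
    using f(3) G[OF f(1)] by (auto simp: p_def q_def permutes_in_image)
  \<comment> \<open>Conjugation by \<open>f\<close> turns a transposition inside one block into one
    that joins two different blocks.\<close>
  have tpq: "transpose p q \<in> G"
    using conj[OF f(1) blocks[OF f(2)]] by (simp add: p_def q_def)
  have star: "transpose p u \<in> G" if u: "u \<in> \<Omega>" for u
  proof (cases "(p, u) \<in> r")
    case True
    then show ?thesis by (rule blocks)
  next
    case pu: False
    show ?thesis
    proof (cases "(q, u) \<in> r")
      \<comment> \<open>Here \<open>u\<close> shares the block of \<open>q\<close>: conjugating the
        transposition of \<open>p\<close> and \<open>q\<close> by that of \<open>q\<close> and
        \<open>u\<close> replaces \<open>q\<close> by \<open>u\<close> and leaves \<open>p\<close>
        in place.\<close>
      case True
      have "u \<noteq> p"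
        using pu refl pq by auto
      moreover have "q \<noteq> p"
        using pq refl by auto
      ultimately show ?thesis
        using conj[OF blocks[OF True] tpq] by (simp add: transpose_def)
    next
      \<comment> \<open>Here \<open>u\<close> lies in a third block: exchanging the blocks of
        \<open>q\<close> and \<open>u\<close> carries \<open>q\<close> to \<open>u\<close> and fixes
        \<open>p\<close>, which lies in neither.\<close>
      case False
      then obtain h where h: "h permutes \<Omega>" "\<forall>x y. (x, y) \<in> r \<longrightarrow> (h x, h y) \<in> r" "h q = u"
        "\<forall>x. (q, x) \<notin> r \<longrightarrow> (u, x) \<notin> r \<longrightarrow> h x = x"
        using exists_block_swap[OF fin r eq pq(2) u] by blast
      then have "h \<in> G"
        by (intro stab) auto
      moreover have "h p = p"
        using h(4) pq(3) pu sym by blast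
      ultimately show ?thesis
        using conj[OF _ tpq, of h] h(3) by simp
    qed
  qed
  have all: "transpose u v \<in> G" if uv: "u \<in> \<Omega>" "v \<in> \<Omega>" for u v
  proof (cases "u = v \<or> v = p")
    case True
    then show ?thesis
      using star[OF uv(1)] idG by (auto simp: transpose_commute)
  next
    \<comment> \<open>With \<open>u\<close>, \<open>v\<close> distinct and \<open>v\<close> not
      \<open>p\<close>, conjugating the transposition of \<open>p\<close> and \<open>v\<close> by
      that of \<open>p\<close> and \<open>u\<close> gives that of \<open>u\<close> and
      \<open>v\<close>.\<close>
    case False
    then show ?thesis
      using conj[OF star[OF uv(1)] star[OF uv(2)]] by (simp add: transpose_def split: if_splits)
  qed
  show ?thesis
    by (rule permutes_induct[OF g fin, of "\<lambda>g. g \<in> G"]) (rule idG, rule comp[OF all])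
qed

text \<open>As simp rules these loop with the characterization of membership in \<open>nlists\<close> that follows.\<close>

declare nlistsE_length [simp del] nlistsE_set [simp del]

section \<open>Tuples, gates and preservation of a binary relation\<close>

lemma in_nlists_iff: "xs \<in> nlists n A \<longleftrightarrow> length xs = n \<and> set xs \<subseteq> A"
  by (auto simp: nlists_def)

lemma in_B_iff: "p \<in> B A \<longleftrightarrow> snd p permutes nlists (fst p) A"
  by (cases p) (simp add: B_def B_n_def)

lemma in_B_D:
  assumes "p \<in> B A" "length xs = fst p" "set xs \<subseteq> A"
  shows "length (snd p xs) = fst p" "set (snd p xs) \<subseteq> A"
proof -
  have "snd p permutes nlists (fst p) A"
    using assms(1) by (simp add: in_B_iff)
  from permutes_in_image[OF this, of xs] have "snd p xs \<in> nlists (fst p) A"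
    using assms(2,3) by (simp add: in_nlists_iff)
  then show "length (snd p xs) = fst p" "set (snd p xs) \<subseteq> A"
    by (auto simp: in_nlists_iff)
qed

lemma binary_array_condition:
  assumes "length xs = n" "length ys = n"
  shows "(\<forall>j<n. column [xs, ys] j \<in> binary_rel \<rho>) \<longleftrightarrow> list_all2 (\<lambda>x y. (x, y) \<in> \<rho>) xs ys"
  using assms by (auto simp: column_def binary_rel_def list_all2_conv_all_nth)

lemma ball_nlists_2: "(\<forall>M\<in>nlists 2 S. P M) \<longleftrightarrow> (\<forall>x\<in>S. \<forall>y\<in>S. P [x, y])"
  by (auto simp: numeral_2_eq_2 nlists_Suc)

text \<open>An array with two rows is a pair of tuples, and its columns lie in the relation exactly
  when the tuples are related coordinatewise. This is the working form of membership in
  \<open>PPol\<close>.\<close>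

lemma in_PPol_binary_rel_iff:
  "p \<in> PPol A 2 (binary_rel \<rho>) \<longleftrightarrow> p \<in> B A \<and>
    (\<forall>xs\<in>nlists (fst p) A. \<forall>ys\<in>nlists (fst p) A. list_all2 (\<lambda>x y. (x, y) \<in> \<rho>) xs ys \<longrightarrow>
      list_all2 (\<lambda>x y. (x, y) \<in> \<rho>) (snd p xs) (snd p ys))" (is "_ \<longleftrightarrow> ?R")
proof (cases "p \<in> B A")
  case True
  obtain n f where p: "p = (n, f)"
    by fastforce
  have len: "length xs = n" "length (f xs) = n" if "xs \<in> nlists n A" for xs
    using that True in_B_D(1)[of p A xs] by (auto simp: p in_nlists_iff)
  have "p \<in> PPol A 2 (binary_rel \<rho>) \<longleftrightarrow> (\<forall>xs\<in>nlists n A. \<forall>ys\<in>nlists n A.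
      (\<forall>j<n. column [xs, ys] j \<in> binary_rel \<rho>) \<longrightarrow>
      (\<forall>j<n. column [f xs, f ys] j \<in> binary_rel \<rho>))"
    using True by (simp add: PPol_def p ball_nlists_2)
  also have "\<dots> \<longleftrightarrow> ?R"
    using True by (simp add: p binary_array_condition len)
  finally show ?thesis .
qed (auto simp: PPol_def)

section \<open>Parallel and serial composition of gates\<close>

lemma fst_par [simp]: "fst (par A p q) = fst p + fst q"
  by (simp add: par_def)

lemma par_apply:
  "xs \<in> nlists (fst p + fst q) A \<Longrightarrow>
    snd (par A p q) xs = snd p (take (fst p) xs) @ snd q (drop (fst p) xs)"
  by (simp add: par_def)

lemma take_drop_in_nlists:
  assumes "xs \<in> nlists (m + n) A"
  shows "take m xs \<in> nlists m A" "drop m xs \<in> nlists n A"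
  using assms set_take_subset[of m xs] set_drop_subset[of m xs] by (auto simp: in_nlists_iff)

lemma finite_nlists: "finite A \<Longrightarrow> finite (nlists n A)"
  using finite_lists_length_eq[of A n] by (simp add: nlists_def conj_commute)

text \<open>Since \<open>p\<close> preserves length, the output splits into the two partial outputs,
  so injectivity passes from the factors to the composite. Finiteness of the set of tuples then
  gives bijectivity.\<close>

lemma par_in_B:
  assumes "finite A" "p \<in> B A" "q \<in> B A"
  shows "par A p q \<in> B A"
proof -
  let ?S = "nlists (fst p + fst q) A" and ?f = "snd (par A p q)"
  have app: "?f xs = snd p (take (fst p) xs) @ snd q (drop (fst p) xs)"
    and len: "length (snd p (take (fst p) xs)) = fst p" and "?f xs \<in> ?S" if "xs \<in> ?S" for xs
    using that take_drop_in_nlists[OF that] in_B_D[OF assms(2), of "take (fst p) xs"]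
      in_B_D[OF assms(3), of "drop (fst p) xs"]
    by (auto simp: par_apply in_nlists_iff)
  then have "?f ` ?S \<subseteq> ?S"
    by blast
  moreover have "inj_on ?f ?S"
  proof (rule inj_onI)
    fix xs ys assume xs: "xs \<in> ?S" and ys: "ys \<in> ?S" and "?f xs = ?f ys"
    then have "snd p (take (fst p) xs) = snd p (take (fst p) ys)"
      "snd q (drop (fst p) xs) = snd q (drop (fst p) ys)"
      using app len by auto
    then have "take (fst p) xs = take (fst p) ys" "drop (fst p) xs = drop (fst p) ys"
      using assms(2,3) by (auto simp: in_B_iff dest: permutes_inj injD)
    then show "xs = ys"
      by (metis append_take_drop_id)
  qed
  ultimately have "bij_betw ?f ?S ?S"
    using finite_nlists[OF assms(1)] by (simp add: bij_betw_def endo_inj_surj)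
  then show ?thesis
    by (auto simp: in_B_iff par_def intro!: bij_imp_permutes)
qed

lemma ident_in_B: "ident n \<in> B A"
  by (simp add: in_B_iff ident_def permutes_id)

text \<open>The functions agree on all lists because a gate fixes every list that is not a tuple of
  its arity.\<close>

lemma par_ident_0: "p \<in> B A \<Longrightarrow> par A p (ident 0) = p"
  by (cases p) (auto simp: par_def ident_def fun_eq_iff in_nlists_iff in_B_iff permutes_not_in)

text \<open>Prepares the induction that removes idle wires one at a time.\<close>

lemma par_ident_Suc:
  assumes "p \<in> B A"
  shows "par A (par A p (ident n)) (ident 1) = par A p (ident (Suc n))"
proof (rule prod_eqI)
  show "snd (par A (par A p (ident n)) (ident 1)) = snd (par A p (ident (Suc n)))"
  proof
    fix xs
    show "snd (par A (par A p (ident n)) (ident 1)) xs = snd (par A p (ident (Suc n))) xs"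
    proof (cases "xs \<in> nlists (fst p + Suc n) A")
      case True
      then have "take (fst p + n) xs \<in> nlists (fst p + n) A"
        using take_drop_in_nlists(1)[of xs "fst p + n" 1 A] by simp
      then show ?thesis
        using True by (simp add: par_def ident_def drop_take min_def flip: append_assoc)
          (metis add.commute append_take_drop_id drop_drop append.assoc)
    qed (simp add: par_def ident_def)
  qed
qed (simp add: par_def ident_def)

lemma serial_in_B:
  assumes "finite A" "p \<in> B A" "q \<in> B A"
  shows "serial A p q \<in> B A"
proof -
  have "pad A (max (fst p) (fst q)) p \<in> B A" "pad A (max (fst p) (fst q)) q \<in> B A"
    using assms by (auto simp: pad_def intro: par_in_B ident_in_B)
  then show ?thesis
    by (auto simp: in_B_iff serial_def pad_def ident_def intro!: permutes_compose)
qed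

text \<open>With equal arities the padding adds no wires, so the gates of one arity in a clone are
  closed under ordinary composition.\<close>

lemma serial_same_arity:
  assumes "(n, f) \<in> B A" "(n, g) \<in> B A"
  shows "serial A (n, f) (n, g) = (n, f \<circ> g)"
  using assms by (simp add: serial_def pad_def par_ident_0)

lemma wire_perm_in_B:
  assumes "finite A" "\<alpha> permutes {..<n}"
  shows "wire_perm A n \<alpha> \<in> B A"
proof -
  have "permute_list \<alpha> ` nlists n A \<subseteq> nlists n A"
    using assms(2) by (auto simp: in_nlists_iff)
  moreover have "inj_on (permute_list \<alpha>) (nlists n A)"
  proof (rule inj_onI)
    fix xs ys assume xs: "xs \<in> nlists n A" and ys: "ys \<in> nlists n A"
      and eq: "permute_list \<alpha> xs = permute_list \<alpha> ys"
    have "permute_list (inv \<alpha>) (permute_list \<alpha> zs) = zs" if "zs \<in> nlists n A" for zs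
    proof -
      have "permute_list (\<alpha> \<circ> inv \<alpha>) zs = permute_list (inv \<alpha>) (permute_list \<alpha> zs)"
        using that assms(2) by (intro permute_list_compose) (simp add: in_nlists_iff permutes_inv)
      then show ?thesis
        using assms(2) by (simp add: permutes_inv_o)
    qed
    then show "xs = ys"
      using xs ys eq by metis
  qed
  ultimately have "bij_betw (permute_list \<alpha>) (nlists n A) (nlists n A)"
    using finite_nlists[OF assms(1)] by (simp add: bij_betw_def endo_inj_surj)
  then show ?thesis
    by (auto simp: in_B_iff wire_perm_def intro!: bij_imp_permutes cong: bij_betw_cong)
qed

section \<open>Closure properties of the clone of an equivalence relation\<close>

lemma par_in_PPol_binary_rel:
  assumes "finite A" and p: "p \<in> PPol A 2 (binary_rel \<rho>)" and q: "q \<in> PPol A 2 (binary_rel \<rho>)"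
  shows "par A p q \<in> PPol A 2 (binary_rel \<rho>)"
proof -
  have "list_all2 (\<lambda>x y. (x, y) \<in> \<rho>) (snd (par A p q) xs) (snd (par A p q) ys)"
    if "xs \<in> nlists (fst p + fst q) A" "ys \<in> nlists (fst p + fst q) A"
      "list_all2 (\<lambda>x y. (x, y) \<in> \<rho>) xs ys" for xs ys
    using p q that take_drop_in_nlists[OF that(1)] take_drop_in_nlists[OF that(2)]
    by (auto simp: par_apply in_PPol_binary_rel_iff intro!: list_all2_appendI)
  then show ?thesis
    using assms by (auto simp: in_PPol_binary_rel_iff intro: par_in_B)
qed

lemma ident_in_PPol_binary_rel: "ident n \<in> PPol A 2 (binary_rel \<rho>)"
  by (simp add: in_PPol_binary_rel_iff ident_in_B) (simp add: ident_def)

lemma permutation_clone_PPol_binary_rel: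
  assumes "finite A"
  shows "permutation_clone A (PPol A 2 (binary_rel \<rho>))"
  unfolding permutation_clone_def
proof (intro conjI allI ballI impI)
  show "PPol A 2 (binary_rel \<rho>) \<subseteq> B A"
    by (auto simp: PPol_def)
  show "wire_perm A n \<alpha> \<in> PPol A 2 (binary_rel \<rho>)" if \<alpha>: "\<alpha> permutes {..<n}" for n \<alpha>
  proof -
    show ?thesis
      using wire_perm_in_B[OF assms \<alpha>] \<alpha>
      by (auto simp: in_PPol_binary_rel_iff)
        (auto simp: wire_perm_def in_nlists_iff list_all2_permute_list_iff)
  qed
  fix p q assume p: "p \<in> PPol A 2 (binary_rel \<rho>)" and q: "q \<in> PPol A 2 (binary_rel \<rho>)"
  then show "par A p q \<in> PPol A 2 (binary_rel \<rho>)"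
    by (rule par_in_PPol_binary_rel[OF assms])
  let ?n = "max (fst p) (fst q)"
  have pad: "pad A ?n p \<in> PPol A 2 (binary_rel \<rho>)" "pad A ?n q \<in> PPol A 2 (binary_rel \<rho>)"
    using p q unfolding pad_def
    by (auto intro!: par_in_PPol_binary_rel[OF assms] ident_in_PPol_binary_rel)
  have fst: "fst (pad A ?n p) = ?n" "fst (pad A ?n q) = ?n"
    by (auto simp: pad_def ident_def)
  have "snd (pad A ?n q) permutes nlists ?n A"
    using pad(2) fst(2) by (simp add: in_PPol_binary_rel_iff in_B_iff)
  \<comment> \<open>The padded \<open>q\<close> sends tuples to tuples, so the preservation property
    of the padded \<open>p\<close> applies to its outputs.\<close>
  note permutes_in_image[OF this]
  moreover have "serial A p q \<in> B A"
    using p q by (auto simp: in_PPol_binary_rel_iff intro: serial_in_B[OF assms])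
  ultimately show "serial A p q \<in> PPol A 2 (binary_rel \<rho>)"
    using pad unfolding in_PPol_binary_rel_iff fst by (simp add: serial_def)
qed

text \<open>Reflexivity relates the ancilla value to itself, so related inputs stay related after
  \<open>a\<close> is appended. The outputs of \<open>f\<close> have equal length, so the last
  coordinate can be cut off again.\<close>

lemma ancilla_closed_PPol_binary_rel:
  assumes "equiv A \<rho>"
  shows "ancilla_closed A (PPol A 2 (binary_rel \<rho>))"
  unfolding ancilla_closed_def
proof (intro allI ballI impI)
  fix n f g a
  assume f: "f \<in> B_n A n" and a: "a \<in> A" and g: "(n + 1, g) \<in> PPol A 2 (binary_rel \<rho>)"
    and gf: "\<forall>xs\<in>nlists n A. g (xs @ [a]) = f xs @ [a]"
  have fB: "(n, f) \<in> B A"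
    using f by (simp add: B_def)
  have "list_all2 (\<lambda>x y. (x, y) \<in> \<rho>) (f xs) (f ys)"
    if xs: "xs \<in> nlists n A" and ys: "ys \<in> nlists n A"
      and rel: "list_all2 (\<lambda>x y. (x, y) \<in> \<rho>) xs ys" for xs ys
  proof -
    have "(a, a) \<in> \<rho>"
      using assms a by (auto simp: equiv_def refl_on_def)
    then have "list_all2 (\<lambda>x y. (x, y) \<in> \<rho>) (xs @ [a]) (ys @ [a])"
      using rel by (simp add: list_all2_appendI)
    moreover have "xs @ [a] \<in> nlists (n + 1) A" "ys @ [a] \<in> nlists (n + 1) A"
      using xs ys a by (auto simp: in_nlists_iff)
    ultimately have "list_all2 (\<lambda>x y. (x, y) \<in> \<rho>) (g (xs @ [a])) (g (ys @ [a]))"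
      using g by (simp add: in_PPol_binary_rel_iff)
    moreover have "length (f xs) = length (f ys)"
      using in_B_D(1)[OF fB] xs ys by (simp add: in_nlists_iff)
    ultimately show ?thesis
      using gf xs ys by (simp add: list_all2_append)
  qed
  then show "(n, f) \<in> PPol A 2 (binary_rel \<rho>)"
    using fB by (simp add: in_PPol_binary_rel_iff)
qed

section \<open>Removal of borrowed wires\<close>

text \<open>An idle wire returns whatever value it carries, so any element of the nonempty set
  \<open>A\<close> can act as the ancilla.\<close>

lemma ancilla_closed_imp_borrow_closed:
  assumes "finite A" "A \<noteq> {}" "ancilla_closed A C"
  shows "borrow_closed A C"
  unfolding borrow_closed_def
proof (intro ballI impI)
  fix p assume p: "p \<in> B A" and C: "par A p (ident 1) \<in> C"
  obtain n f where nf: "p = (n, f)"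
    by fastforce
  obtain a where a: "a \<in> A"
    using assms(2) by blast
  define g where "g = snd (par A p (ident 1))"
  have par: "par A p (ident 1) = (n + 1, g)"
    by (rule prod_eqI) (auto simp: g_def nf ident_def)
  have "g (xs @ [a]) = f xs @ [a]" if "xs \<in> nlists n A" for xs
    using that a by (auto simp: g_def nf par_def ident_def in_nlists_iff)
  moreover have "f \<in> B_n A n" "g \<in> B_n A (n + 1)"
    using p par_in_B[OF assms(1) p ident_in_B, of 1] unfolding par by (auto simp: nf B_def)
  ultimately have "(n, f) \<in> C"
    using assms(3) a C unfolding ancilla_closed_def par by blast
  then show "p \<in> C"
    by (simp add: nf)
qed

lemma borrow_closed_par_ident:
  assumes "finite A" "borrow_closed A C" "p \<in> B A" "par A p (ident n) \<in> C"
  shows "p \<in> C"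
  using assms(4)
proof (induction n)
  case 0
  then show ?case
    using par_ident_0[OF assms(3)] by simp
next
  case (Suc n)
  have "par A p (ident n) \<in> B A"
    using assms by (intro par_in_B ident_in_B)
  moreover have "par A (par A p (ident n)) (ident 1) \<in> C"
    using Suc.prems par_ident_Suc[OF assms(3), of n] by simp
  ultimately have "par A p (ident n) \<in> C"
    using assms(2) by (auto simp: borrow_closed_def)
  then show ?case
    by (rule Suc.IH)
qed

section \<open>The coordinatewise power of an equivalence relation\<close>

text \<open>The blocks on the tuples of length \<open>n\<close>: products of \<open>n\<close>
  classes of \<rho>. Fixing the length of \<open>xs\<close> also fixes that of \<open>ys\<close>,
  since \<open>list_all2\<close> forces equal lengths.\<close>

definition tuple_rel :: "('a \<times> 'a) set \<Rightarrow> nat \<Rightarrow> ('a list \<times> 'a list) set" where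
  "tuple_rel \<rho> n = {(xs, ys). length xs = n \<and> list_all2 (\<lambda>x y. (x, y) \<in> \<rho>) xs ys}"

lemma equiv_tuple_rel:
  assumes "equiv A \<rho>"
  shows "equiv (nlists n A) (tuple_rel \<rho> n)"
proof -
  have sub: "\<rho> \<subseteq> A \<times> A" and sym: "sym \<rho>" and trans: "trans \<rho>"
    and refl: "\<And>x. x \<in> A \<Longrightarrow> (x, x) \<in> \<rho>"
    using assms by (auto simp: equiv_def refl_on_def)
  have "set xs \<subseteq> A \<and> set ys \<subseteq> A" if "list_all2 (\<lambda>x y. (x, y) \<in> \<rho>) xs ys" for xs ys
    using that sub by (induction rule: list_all2_induct) auto
  then have "tuple_rel \<rho> n \<subseteq> nlists n A \<times> nlists n A"
    by (auto simp: tuple_rel_def in_nlists_iff) (metis list_all2_lengthD)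
  moreover have "(xs, xs) \<in> tuple_rel \<rho> n" if "xs \<in> nlists n A" for xs
    using that refl by (auto simp: tuple_rel_def in_nlists_iff intro!: list.rel_refl_strong)
  moreover have "sym (tuple_rel \<rho> n)"
    using sym by (auto simp: tuple_rel_def sym_def list_all2_conv_all_nth)
  moreover have "trans (tuple_rel \<rho> n)"
    using list_all2_trans[of "\<lambda>x y. (x, y) \<in> \<rho>" "\<lambda>x y. (x, y) \<in> \<rho>" "\<lambda>x y. (x, y) \<in> \<rho>"]
      transD[OF trans] list_all2_lengthD
    unfolding tuple_rel_def trans_def by blast
  ultimately show ?thesis
    by (auto simp: equiv_def refl_on_def)
qed

text \<open>The class of a tuple is the product of the classes of its entries. Thus equal class
  sizes for \<rho> give blocks of equal size in every arity.\<close>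

lemma card_tuple_rel_class:
  assumes "\<And>x. x \<in> A \<Longrightarrow> card (\<rho> `` {x}) = s" "xs \<in> nlists n A"
  shows "card (tuple_rel \<rho> n `` {xs}) = s ^ n"
proof -
  have "card {ys. list_all2 (\<lambda>x y. (x, y) \<in> \<rho>) xs ys} = s ^ length xs" if "set xs \<subseteq> A" for xs
    using that
  proof (induction xs)
    case (Cons x xs)
    have "{ys. list_all2 (\<lambda>x y. (x, y) \<in> \<rho>) (x # xs) ys} =
        (\<lambda>(y, ys). y # ys) ` (\<rho> `` {x} \<times> {ys. list_all2 (\<lambda>x y. (x, y) \<in> \<rho>) xs ys})"
      by (auto simp: list_all2_Cons1)
    moreover have "inj_on (\<lambda>(y, ys). y # ys) S" for S :: "('a \<times> 'a list) set"
      by (auto simp: inj_on_def)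
    ultimately show ?case
      using Cons assms(1) by (simp add: card_image card_cartesian_product)
  next
    case Nil
    have "{ys. list_all2 (\<lambda>x y. (x, y) \<in> \<rho>) [] ys} = {[]}"
      by auto
    then show ?case
      by simp
  qed
  then show ?thesis
    using assms(2) by (simp add: tuple_rel_def in_nlists_iff Image_def)
qed

section \<open>Clones strictly above the clone of the relation\<close>

text \<open>Block stabilizer maximality is applied to the gates of arity \<open>n\<close> in
  \<open>C\<close>: they contain the stabilizer of \<open>tuple_rel\<close> because \<open>C\<close>
  contains \<open>PPol\<close>, and \<open>f\<close> is the element that breaks a block.\<close>

lemma clone_above_PPol_contains_arity:
  assumes A: "finite A" "equiv A \<rho>" "\<And>x. x \<in> A \<Longrightarrow> card (\<rho> `` {x}) = s"
    and C: "permutation_clone A C" "PPol A 2 (binary_rel \<rho>) \<subseteq> C"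
    and f: "(n, f) \<in> C" "(n, f) \<notin> PPol A 2 (binary_rel \<rho>)"
    and g: "(n, g) \<in> B A"
  shows "(n, g) \<in> C"
proof -
  have CB: "C \<subseteq> B A"
    using C(1) by (simp add: permutation_clone_def)
  then obtain xs ys where xy: "xs \<in> nlists n A" "ys \<in> nlists n A"
    "list_all2 (\<lambda>x y. (x, y) \<in> \<rho>) xs ys" "\<not> list_all2 (\<lambda>x y. (x, y) \<in> \<rho>) (f xs) (f ys)"
    using f by (auto simp: in_PPol_binary_rel_iff)
  have "g \<in> {g. (n, g) \<in> C}"
  proof (rule block_stabilizer_maximal[OF finite_nlists[OF A(1)] equiv_tuple_rel[OF A(2)]])
    show "card (tuple_rel \<rho> n `` {xs}) = card (tuple_rel \<rho> n `` {ys})"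
      if "xs \<in> nlists n A" "ys \<in> nlists n A" for xs ys
      using card_tuple_rel_class[OF A(3)] that by simp
    show "h permutes nlists n A" if "h \<in> {g. (n, g) \<in> C}" for h
      using that CB by (auto simp: in_B_iff)
    show "h \<circ> k \<in> {g. (n, g) \<in> C}" if "h \<in> {g. (n, g) \<in> C}" "k \<in> {g. (n, g) \<in> C}" for h k
    proof -
      have "serial A (n, h) (n, k) \<in> C"
        using that C(1) by (simp add: permutation_clone_def)
      then show ?thesis
        using that CB serial_same_arity[of n h A k] by (metis mem_Collect_eq subsetD)
    qed
    show "h \<in> {g. (n, g) \<in> C}"
      if "h permutes nlists n A"
        "\<And>x y. (x, y) \<in> tuple_rel \<rho> n \<Longrightarrow> (h x, h y) \<in> tuple_rel \<rho> n" for h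
    proof -
      have "(n, h) \<in> PPol A 2 (binary_rel \<rho>)"
        using that by (auto simp: in_PPol_binary_rel_iff in_B_iff tuple_rel_def in_nlists_iff)
      then show ?thesis
        using C(2) by auto
    qed
    show "f \<in> {g. (n, g) \<in> C}"
      using f by simp
    show "(xs, ys) \<in> tuple_rel \<rho> n" "(f xs, f ys) \<notin> tuple_rel \<rho> n"
      using xy by (auto simp: tuple_rel_def in_nlists_iff)
    show "g permutes nlists n A"
      using g by (simp add: in_B_iff)
  qed
  then show ?thesis
    by simp
qed

text \<open>A pair of inputs on which \<open>p\<close> fails is extended by the same constant tuple
  on the idle wires, and the failure persists. A gate outside the clone can thus be raised to any
  larger arity.\<close>

lemma par_ident_not_in_PPol_binary_rel:
  assumes A: "equiv A \<rho>" "A \<noteq> {}"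
    and p: "p \<in> B A" "p \<notin> PPol A 2 (binary_rel \<rho>)"
  shows "par A p (ident k) \<notin> PPol A 2 (binary_rel \<rho>)"
proof
  assume P: "par A p (ident k) \<in> PPol A 2 (binary_rel \<rho>)"
  obtain xs ys where xy: "xs \<in> nlists (fst p) A" "ys \<in> nlists (fst p) A"
    "list_all2 (\<lambda>x y. (x, y) \<in> \<rho>) xs ys"
    and not: "\<not> list_all2 (\<lambda>x y. (x, y) \<in> \<rho>) (snd p xs) (snd p ys)"
    using p by (auto simp: in_PPol_binary_rel_iff)
  obtain a where a: "a \<in> A"
    using A(2) by blast
  then have "(a, a) \<in> \<rho>"
    using A(1) by (auto simp: equiv_def refl_on_def)
  define z where "z = replicate k a"
  have "list_all2 (\<lambda>x y. (x, y) \<in> \<rho>) (xs @ z) (ys @ z)"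
    using xy \<open>(a, a) \<in> \<rho>\<close> by (auto simp: z_def intro!: list_all2_appendI list.rel_refl_strong)
  moreover have xz: "xs @ z \<in> nlists (fst p + k) A" "ys @ z \<in> nlists (fst p + k) A"
    using xy a by (auto simp: z_def in_nlists_iff)
  ultimately have "list_all2 (\<lambda>x y. (x, y) \<in> \<rho>)
      (snd (par A p (ident k)) (xs @ z)) (snd (par A p (ident k)) (ys @ z))"
    using P by (auto simp: in_PPol_binary_rel_iff ident_def)
  then have "list_all2 (\<lambda>x y. (x, y) \<in> \<rho>) (snd p xs @ z) (snd p ys @ z)"
    using xz xy by (simp add: par_def ident_def in_nlists_iff)
  moreover have "length (snd p xs) = length (snd p ys)"
    using in_B_D(1)[OF p(1)] xy by (simp add: in_nlists_iff)
  ultimately show False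
    using not by (simp add: list_all2_append)
qed

text \<open>The gate \<open>p\<close> outside \<open>PPol\<close> and the target \<open>q\<close>
  may differ in arity. Both are padded to the common arity \<open>k\<close>, where \<open>C\<close>
  contains everything, and the wires added to \<open>q\<close> are then removed by
  borrowing.\<close>

lemma borrow_closed_clone_above_PPol:
  assumes A: "finite A" "equiv A \<rho>" "A \<noteq> {}" "\<And>x. x \<in> A \<Longrightarrow> card (\<rho> `` {x}) = s"
    and C: "permutation_clone A C" "borrow_closed A C" "PPol A 2 (binary_rel \<rho>) \<subset> C"
  shows "B A \<subseteq> C"
proof
  fix q assume q: "q \<in> B A"
  obtain p where p: "p \<in> C" "p \<notin> PPol A 2 (binary_rel \<rho>)"
    using C(3) by blast
  define k where "k = max (fst p) (fst q)"
  define P Q where "P = par A p (ident (k - fst p))" and "Q = par A q (ident (k - fst q))"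
  have pB: "p \<in> B A"
    using p C(1) by (auto simp: permutation_clone_def)
  have fst: "fst P = k" "fst Q = k"
    by (auto simp: P_def Q_def k_def ident_def)
  have "ident (k - fst p) \<in> C"
    using C(3) ident_in_PPol_binary_rel by blast
  then have "P \<in> C"
    using p C(1) by (simp add: P_def permutation_clone_def)
  moreover have "P \<notin> PPol A 2 (binary_rel \<rho>)"
    unfolding P_def by (rule par_ident_not_in_PPol_binary_rel[OF A(2,3) pB p(2)])
  moreover have "Q \<in> B A"
    unfolding Q_def using A q by (intro par_in_B ident_in_B)
  ultimately have "Q \<in> C"
    using clone_above_PPol_contains_arity[OF A(1,2,4) C(1) psubset_imp_subset[OF C(3)],
        of k "snd P" "snd Q"] fst by (metis prod.collapse)
  then show "q \<in> C"
    unfolding Q_def by (rule borrow_closed_par_ident[OF A(1) C(2) q])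
qed

text \<open>A gate on one wire breaks \<rho>: with \<open>x\<close>, \<open>y\<close> distinct and
  related and \<open>z\<close> outside their class, exchanging \<open>x\<close> and \<open>z\<close>
  fixes \<open>y\<close> and separates \<open>x\<close> from \<open>y\<close>.\<close>

lemma PPol_binary_rel_proper:
  assumes "equiv A \<rho>" "\<rho> \<noteq> Id_on A" "\<rho> \<noteq> A \<times> A"
  shows "PPol A 2 (binary_rel \<rho>) \<noteq> B A"
proof
  assume eq: "PPol A 2 (binary_rel \<rho>) = B A"
  have sub: "\<rho> \<subseteq> A \<times> A" and sym: "\<And>x y. (x, y) \<in> \<rho> \<Longrightarrow> (y, x) \<in> \<rho>"
    and trans: "\<And>x y z. (x, y) \<in> \<rho> \<Longrightarrow> (y, z) \<in> \<rho> \<Longrightarrow> (x, z) \<in> \<rho>"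
    and refl: "\<And>x. x \<in> A \<Longrightarrow> (x, x) \<in> \<rho>"
    using assms(1) by (auto simp: equiv_def refl_on_def dest: symD transD)
  obtain x y where xy: "(x, y) \<in> \<rho>" "x \<noteq> y"
    using assms(2) sub refl by (auto simp: Id_on_def)
  obtain u v where uv: "u \<in> A" "v \<in> A" "(u, v) \<notin> \<rho>"
    using assms(3) sub by auto
  \<comment> \<open>\<open>x\<close> cannot be related to both \<open>u\<close> and
    \<open>v\<close>, so one of them serves as \<open>z\<close>.\<close>
  then obtain z where z: "z \<in> A" "(x, z) \<notin> \<rho>"
    using sym[of x u] trans[of u x v] by blast
  let ?t = "transpose [x] [z]"
  have "(1, ?t) \<in> B A"
    using z xy sub by (auto simp: in_B_iff in_nlists_iff intro!: permutes_swap_id)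
  then have "(1, ?t) \<in> PPol A 2 (binary_rel \<rho>)"
    by (simp only: eq)
  then have pres: "\<forall>xs\<in>nlists 1 A. \<forall>ys\<in>nlists 1 A. list_all2 (\<lambda>x y. (x, y) \<in> \<rho>) xs ys \<longrightarrow>
      list_all2 (\<lambda>x y. (x, y) \<in> \<rho>) (?t xs) (?t ys)"
    by (simp add: in_PPol_binary_rel_iff)
  have "[x] \<in> nlists 1 A" "[y] \<in> nlists 1 A" "list_all2 (\<lambda>x y. (x, y) \<in> \<rho>) [x] [y]"
    using xy sub by (auto simp: in_nlists_iff)
  then have "list_all2 (\<lambda>x y. (x, y) \<in> \<rho>) (?t [x]) (?t [y])"
    by (rule pres[rule_format])
  moreover have "y \<noteq> z"
    using xy z by auto
  ultimately have "(z, y) \<in> \<rho>"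
    using xy by (simp add: transpose_def)
  then show False
    using xy z sym[of z y] trans[of x y z] by blast
qed

theorem theorem6:
  fixes A :: "'a set" and \<rho> :: "('a \<times> 'a) set"
  assumes "finite A"
    and "equiv A \<rho>"
    and "\<rho> \<noteq> Id_on A"
    and "\<rho> \<noteq> A \<times> A"
    and "\<forall>X \<in> A // \<rho>. \<forall>Y \<in> A // \<rho>. card X = card Y"
  shows "permutation_clone A (PPol A 2 (binary_rel \<rho>))
    \<and> PPol A 2 (binary_rel \<rho>) \<subset> B A
    \<and> borrow_closed A (PPol A 2 (binary_rel \<rho>))
    \<and> ancilla_closed A (PPol A 2 (binary_rel \<rho>))
    \<and> (\<nexists>C. permutation_clone A C \<and> borrow_closed A C
            \<and> PPol A 2 (binary_rel \<rho>) \<subset> C \<and> C \<subset> B A)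
    \<and> (\<nexists>C. permutation_clone A C \<and> ancilla_closed A C
            \<and> PPol A 2 (binary_rel \<rho>) \<subset> C \<and> C \<subset> B A)"
proof -
  let ?P = "PPol A 2 (binary_rel \<rho>)"
  \<comment> \<open>On an empty set the only equivalence is the empty one, which equals the full
    relation.\<close>
  have ne: "A \<noteq> {}"
    using assms(2,4) by (auto simp: equiv_def refl_on_def)
  then obtain a where a: "a \<in> A"
    by blast
  have card: "card (\<rho> `` {x}) = card (\<rho> `` {a})" if "x \<in> A" for x
    using assms(5) a that by (blast intro: quotientI)
  have max: "B A \<subseteq> C" if "permutation_clone A C" "borrow_closed A C" "?P \<subset> C" for C
    using borrow_closed_clone_above_PPol[OF assms(1,2) ne card that] .
  \<comment> \<open>Ancilla closed clones are borrow closed, so maximality among the latter settles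
    both claims.\<close>
  have anc: "borrow_closed A C" if "ancilla_closed A C" for C
    by (rule ancilla_closed_imp_borrow_closed[OF assms(1) ne that])
  have "permutation_clone A ?P" "ancilla_closed A ?P" "?P \<noteq> B A"
    using permutation_clone_PPol_binary_rel[OF assms(1)] ancilla_closed_PPol_binary_rel[OF assms(2)]
      PPol_binary_rel_proper[OF assms(2-4)] by auto
  moreover from this have "?P \<subset> B A"
    by (auto simp: permutation_clone_def)
  ultimately show ?thesis
    using max anc by blast
qed

end
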